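(* Let $A\in\mathbb{C}^{n\times n}$ be a singular matrix such that the matrix system $$AXA=A\quad\wedge\quad AX=XA$$ in the unknown $X\in\mathbb{C}^{n\times n}$ is consistent, and let $\bar{A}$ be a commutative $\{1\}$-inverse of $A$. If $X_0$ is any solution of this system, then the formula $$X=g(Y)=X_0+Y-\bar{A}AY-YA\bar{A}+\bar{A}AYA\bar{A},$$ where $Y\in\mathbb{C}^{n\times n}$ is arbitrary, determines a form of the general solution of the system. If $X_0\neq\bar{A}A\bar{A}$, then $X=g(Y)$ is a general non-reproductive solution.
   Context: A commutative $\{1\}$-inverse of $A$ is a matrix $\bar{A}\in\mathbb{C}^{n\times n}$ with $A\bar{A}A=A$ and $A\bar{A}=\bar{A}A$. A system is consistent if it has at least one solution. For a function $\phi:S\to S$ (here $S=\mathbb{C}^{n\times n}$), the formula $x=\phi(t)$ represents the general solution of an equation or system $J(x)$ if $J(\phi(t))$ holds for every $t\in S$ and every solution $x$ equals $\phi(t)$ for some $t\in S$. It represents the reproductive general solution if $J(\phi(t))$ holds for every $t\in S$ and $\phi(t)=t$ for every solution $t$ of $J$. A general solution that is not reproductive is called a general non-reproductive solution. *)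

theory Defs
  imports "HOL-Analysis.Analysis"
begin

definition commutative_1_inverse :: "complex^'n^'n \<Rightarrow> complex^'n^'n \<Rightarrow> bool" where
  "commutative_1_inverse A X \<longleftrightarrow> A ** X ** A = A \<and> A ** X = X ** A"

definition consistent :: "('s \<Rightarrow> bool) \<Rightarrow> bool" where
  "consistent J \<longleftrightarrow> (\<exists>x. J x)"

text \<open>The ambient set of the unknown and of the parameter is the whole type \<^typ>\<open>'s\<close>.\<close>

definition general_solution :: "('s \<Rightarrow> bool) \<Rightarrow> ('s \<Rightarrow> 's) \<Rightarrow> bool" where
  "general_solution J \<phi> \<longleftrightarrow> (\<forall>t. J (\<phi> t)) \<and> (\<forall>x. J x \<longrightarrow> (\<exists>t. x = \<phi> t))"

definition reproductive_general_solution :: "('s \<Rightarrow> bool) \<Rightarrow> ('s \<Rightarrow> 's) \<Rightarrow> bool" where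
  "reproductive_general_solution J \<phi> \<longleftrightarrow> (\<forall>t. J (\<phi> t)) \<and> (\<forall>t. J t \<longrightarrow> \<phi> t = t)"

definition general_nonreproductive_solution :: "('s \<Rightarrow> bool) \<Rightarrow> ('s \<Rightarrow> 's) \<Rightarrow> bool" where
  "general_nonreproductive_solution J \<phi> \<longleftrightarrow>
     general_solution J \<phi> \<and> \<not> reproductive_general_solution J \<phi>"

end

theory Submission
  imports Defs
begin

text \<open>
  All commutative \<open>{1}\<close>-inverses \<open>X\<close> of \<open>A\<close> give the same product \<open>A X = X A\<close>, namely the idempotent
  \<open>P = A A' = A' A\<close>, which satisfies \<open>A P = P A = A\<close>. Conversely, any \<open>X\<close> with
  \<open>A X = X A = P\<close> solves the system. The system is therefore equivalent to an inhomogeneous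
  \<^emph>\<open>linear\<close> one, whose solutions are \<open>X\<^sub>0\<close> plus the solutions \<open>Z\<close> of \<open>A Z = Z A = 0\<close>.
  Now \<open>Y \<mapsto> (1 - P) Y (1 - P)\<close> is a projection onto exactly these \<open>Z\<close>, and
  \<open>g Y = X\<^sub>0 + (1 - P) Y (1 - P)\<close>; so \<open>g\<close> parametrises the solution set, with
  \<open>g (X - X\<^sub>0) = X\<close> for every solution \<open>X\<close>.

  For any solution \<open>X\<close>, each of \<open>P X\<close>, \<open>X P\<close>, \<open>P X P\<close> equals \<open>A' A A'\<close>, hence
  \<open>g X = X + (X\<^sub>0 - A' A A')\<close>: on the solution set \<open>g\<close> is a translation, and it can only be the identity
  there if \<open>X\<^sub>0 = A' A A'\<close>.
\<close>

lemma matrix_diff_ldistrib: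
  fixes A :: "'a::ring_1^'n^'m" and B C :: "'a^'p^'n"
  shows "A ** (B - C) = A ** B - A ** C"
  by (simp add: vec_eq_iff matrix_matrix_mult_def right_diff_distrib sum_subtractf)

lemma matrix_add_rdistrib:
  fixes A B :: "'a::semiring_1^'n^'m" and C :: "'a^'p^'n"
  shows "(A + B) ** C = A ** C + B ** C"
  by (simp add: vec_eq_iff matrix_matrix_mult_def distrib_right sum.distrib)

lemma matrix_diff_rdistrib:
  fixes A B :: "'a::ring_1^'n^'m" and C :: "'a^'p^'n"
  shows "(A - B) ** C = A ** C - B ** C"
  by (simp add: vec_eq_iff matrix_matrix_mult_def left_diff_distrib sum_subtractf)

text \<open>Cancelling \<open>A\<close> across the commuting factors: \<open>A X = (A A' A) X = A' A (A X) = A' (A X A) = A' A\<close>.\<close>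

lemma commutative_1_inverse_product_unique:
  assumes A': "commutative_1_inverse A A'" and X: "commutative_1_inverse A X"
  shows "A ** X = A' ** A"
proof -
  have "A ** X = A' ** A ** (A ** X)"
    using A' by (metis commutative_1_inverse_def matrix_mul_assoc)
  also have "\<dots> = A' ** (A ** X ** A)"
    using X by (metis commutative_1_inverse_def matrix_mul_assoc)
  also have "\<dots> = A' ** A"
    using X by (metis commutative_1_inverse_def)
  finally show ?thesis .
qed

lemma commutative_1_inverse_iff_products:
  assumes A': "commutative_1_inverse A A'"
  shows "commutative_1_inverse A X \<longleftrightarrow> A ** X = A' ** A \<and> X ** A = A' ** A"
  using commutative_1_inverse_product_unique[OF A'] A'
  by (metis commutative_1_inverse_def)

text \<open>With \<open>P = A' A = A A'\<close>, these are \<open>P X = A' (A X) = A' P\<close> and \<open>X P = (X A) A' = P A'\<close>. They do not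
  depend on \<open>X\<close>, so the parametrisation changes a solution only by a constant.\<close>

lemma commutative_1_inverse_one_sided_products:
  assumes A': "commutative_1_inverse A A'" and X: "commutative_1_inverse A X"
  shows "A' ** A ** X = A' ** A ** A'"
    and "X ** A ** A' = A' ** A ** A'"
proof -
  have AX: "A ** X = A' ** A" "X ** A = A' ** A"
    using commutative_1_inverse_iff_products[OF A'] X by auto
  have AA': "A ** A' = A' ** A"
    using A' by (simp add: commutative_1_inverse_def)
  show "A' ** A ** X = A' ** A ** A'"
    by (metis AX(1) AA' matrix_mul_assoc)
  show "X ** A ** A' = A' ** A ** A'"
    by (simp add: AX(2))
qed

theorem mainTheorem6:
  fixes A A' X\<^sub>0 :: "complex^'n^'n"
    and J :: "complex^'n^'n \<Rightarrow> bool"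
    and g :: "complex^'n^'n \<Rightarrow> complex^'n^'n"
  defines "J \<equiv> \<lambda>X. A ** X ** A = A \<and> A ** X = X ** A"
    and "g \<equiv> \<lambda>Y. X\<^sub>0 + Y - A' ** A ** Y - Y ** A ** A' + A' ** A ** Y ** A ** A'"
  assumes "\<not> invertible A"
    and "consistent J"
    and "commutative_1_inverse A A'"
    and "J X\<^sub>0"
  shows "general_solution J g \<and>
         (X\<^sub>0 \<noteq> A' ** A ** A' \<longrightarrow> general_nonreproductive_solution J g)"
proof -
  note A' = \<open>commutative_1_inverse A A'\<close>
  have J_iff: "J X \<longleftrightarrow> commutative_1_inverse A X" for X
    by (simp add: J_def commutative_1_inverse_def)
  have J_linear: "J X \<longleftrightarrow> A ** X = A' ** A \<and> X ** A = A' ** A" for X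
    using commutative_1_inverse_iff_products[OF A'] by (simp add: J_iff)
  note distribs = matrix_add_ldistrib matrix_add_rdistrib matrix_diff_ldistrib matrix_diff_rdistrib
  have "J (g Y)" for Y
  proof -
    have left: "A ** (A' ** A ** Z) = A ** Z" for Z :: "complex^'n^'n"
      using A' by (metis commutative_1_inverse_def matrix_mul_assoc)
    have right: "Z ** A ** A' ** A = Z ** A" for Z :: "complex^'n^'n"
      using A' by (metis commutative_1_inverse_def matrix_mul_assoc)
    have "A ** (A' ** A ** Y ** A ** A') = A ** (Y ** A ** A')"
      using left[of "Y ** A ** A'"] by (simp add: matrix_mul_assoc)
    then have "A ** g Y = A ** X\<^sub>0"
      by (simp add: g_def distribs left)
    moreover have "g Y ** A = X\<^sub>0 ** A"
      by (simp add: g_def distribs right)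
    ultimately show ?thesis
      using \<open>J X\<^sub>0\<close> by (simp add: J_linear)
  qed
  moreover have "X = g (X - X\<^sub>0)" if "J X" for X
  proof -
    have "commutative_1_inverse A X" "commutative_1_inverse A X\<^sub>0"
      using that \<open>J X\<^sub>0\<close> by (auto simp: J_iff)
    then show ?thesis
      by (simp add: g_def distribs commutative_1_inverse_one_sided_products[OF A'])
  qed
  ultimately have general: "general_solution J g"
    unfolding general_solution_def by blast
  have "A' ** A ** A' ** A ** A' = A' ** A ** A'"
    using A' by (metis commutative_1_inverse_def matrix_mul_assoc)
  then have "g X\<^sub>0 = X\<^sub>0 + (X\<^sub>0 - A' ** A ** A')"
    using \<open>J X\<^sub>0\<close> by (simp add: g_def J_iff commutative_1_inverse_one_sided_products[OF A'])
  then have "X\<^sub>0 = A' ** A ** A'" if "reproductive_general_solution J g"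
    using that \<open>J X\<^sub>0\<close> by (simp add: reproductive_general_solution_def)
  with general show ?thesis
    unfolding general_nonreproductive_solution_def by blast
qed

end
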